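(* Let $\Sigma=\Sigma_c\,\dot\cup\,\Sigma_{uc}$ be a finite alphabet, let $L^*_P\subseteq\Sigma^*$ be prefix-closed, let $\mathcal{L}_P\subseteq\Sigma^\omega$ with $\mathrm{Pre}(\mathcal{L}_P)\subseteq L^*_P$, and let $\mathcal{L}_S\subseteq\Sigma^\omega$. Suppose $(M,\mathcal{F}^S_P,\mathcal{F}^R_S)$ is a Streett/Rabin supervisor synthesis automaton realizing $((L^*_P,\mathcal{L}_P),\mathcal{L}_S)$. Let $f:\Sigma^*\to\Gamma$ be a string-based supervisor and $\check f:P(M)\to\Gamma$ a path-based supervisor such that for all $s\in L^*(M)$ we have $f(s)=\check f(\pi_s)$, where $\pi_s$ is the unique element of $\mathrm{Paths}_M(s)$. Then $f$ solves the string-based supervisor synthesis problem over $((L^*_P,\mathcal{L}_P),\mathcal{L}_S)$ if and only if $\check f$ solves the path-based supervisor synthesis problem over $(M,\mathcal{F}^S_P,\mathcal{F}^R_S)$.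
   Context: Words and languages: for a finite alphabet $\Sigma$, $\Sigma^*$ and $\Sigma^\omega$ are the finite and infinite words. For a word $w$, $\mathrm{Pre}(w)$ is the set of its finite prefixes; for a language $L$, $\mathrm{Pre}(L)=\bigcup_{w\in L}\mathrm{Pre}(w)$; $L$ is prefix-closed if $L=\mathrm{Pre}(L)$. For $L\subseteq\Sigma^*$, $\mathrm{Lim}(L)$ is the set of $\alpha\in\Sigma^\omega$ having infinitely many prefixes in $L$ (the same operator is applied to sets of finite state sequences). Control patterns and string-based supervisors: $\Gamma=\{\gamma\subseteq\Sigma:\Sigma_{uc}\subseteq\gamma\}$. A string-based supervisor is a map $f:\Sigma^*\to\Gamma$. A word $s\in\Sigma^*$ is consistent with $f$ if for all $t\in\Sigma^*$, $\sigma\in\Sigma$ with $t\sigma\in\mathrm{Pre}(s)$ we have $\sigma\in f(t)$; $L^*_f$ is the set of words consistent with $f$ and $\mathcal{L}_f=\mathrm{Lim}(L^*_f)$. $f$ solves the string-based supervisor synthesis problem over $((L^*_P,\mathcal{L}_P),\mathcal{L}_S)$ if (i) $\emptyset\subsetneq \mathcal{L}_f\cap\mathcal{L}_P\subseteq\mathcal{L}_S$ and (ii) $L^*_f\cap L^*_P\subseteq\mathrm{Pre}(\mathcal{L}_f\cap\mathcal{L}_P)$. Finite state machines: $M=(X,\Sigma,\delta,x_0)$ with finite state set $X$, initial state $x_0$, partial transition function $\delta:X\times\Sigma\rightharpoonup 2^X$; $M$ is deterministic if whenever $\delta(x,\sigma)$ is defined it is a singleton. A path is a finite or infinite sequence $\pi=x_0x_1\dots$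 such that for each consecutive pair there is $\sigma_k$ with $x_{k+1}\in\delta(x_k,\sigma_k)$; $P(M)$ (resp. $\mathcal{P}(M)$) is the set of finite (resp. infinite) paths. For $s=\sigma_0\sigma_1\dots\in\Sigma^*\cup\Sigma^\omega$, $\mathrm{Paths}_M(s)$ is the set of paths $x_0x_1\dots$ of length $|s|+1$ with $x_{k+1}\in\delta(x_k,\sigma_k)$ for all $k$. $L^*(M)=\{s\in\Sigma^*:\mathrm{Paths}_M(s)\neq\emptyset\}$, $\mathcal{L}(M)=\{s\in\Sigma^\omega:\mathrm{Paths}_M(s)\ne\emptyset\}$. For an infinite path $\pi$, $\mathrm{Inf}(\pi)$ is the set of states occurring infinitely often. For a family $\mathcal{F}=\{(G_1,R_1),\dots,(G_m,R_m)\}$ of pairs of subsets of $X$: $\pi$ satisfies the Rabin condition $\mathcal{F}$ if there is $i$ with $\mathrm{Inf}(\pi)\cap G_i\neq\emptyset$ and $\mathrm{Inf}(\pi)\cap R_i=\emptyset$; it satisfies the Streett condition $\mathcal{F}$ if for all $i$, $\mathrm{Inf}(\pi)\cap G_i=\emptyset$ or $\mathrm{Inf}(\pi)\cap R_i\ne\emptyset$. $\mathcal{P}(M,\mathcal{F})$ is the set of infinite paths satisfying $\mathcal{F}$ and $\mathcal{L}(M,\mathcal{F})$ the set of $s\in\Sigma^\omega$ having some path in $\mathrm{Paths}_M(s)$ satisfying $\mathcal{F}$. Synthesis automaton: $(M,\mathcal{F}^S_P,\mathcal{F}^R_S)$, with $\mathcal{F}^S_P$ a Streett condition and $\mathcal{F}^R_S$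 a Rabin condition over $M$, is a Streett/Rabin supervisor synthesis automaton realizing $((L^*_P,\mathcal{L}_P),\mathcal{L}_S)$ if (a) $L^*_P=L^*(M)$, (b) $\mathcal{L}_P=\mathcal{L}(M,\mathcal{F}^S_P)$, (c) $\mathcal{L}_S=\mathcal{L}(M,\mathcal{F}^R_S)$, (d) $M$ is deterministic, and (e) for all $x\in X$ and $\sigma,\sigma'\in\Sigma$ with $\delta(x,\sigma),\delta(x,\sigma')$ defined, $\delta(x,\sigma)=\delta(x,\sigma')$ implies $\sigma=\sigma'$. Path-based supervisors: a map $\check f:P(M)\to\Gamma$. A path $\pi$ is consistent with $\check f$ if for all $x,x'\in X$ and $\nu\in X^*$ with $\nu x x'$ a prefix of $\pi$ there is $\sigma\in\check f(\nu x)$ with $\delta(x,\sigma)=\{x'\}$. $P(M,\check f)$ is the set of finite paths consistent with $\check f$ and $\mathcal{P}(M,\check f)=\mathrm{Lim}(P(M,\check f))$. $\check f$ solves the path-based supervisor synthesis problem over $(M,\mathcal{F}^S_P,\mathcal{F}^R_S)$ if $\emptyset\subsetneq\mathcal{P}(M,\check f)\cap\mathcal{P}(M,\mathcal{F}^S_P)\subseteq\mathcal{P}(M,\mathcal{F}^R_S)$ and $P(M,\check f)\subseteq\mathrm{Pre}(\mathcal{P}(M,\check f)\cap\mathcal{P}(M,\mathcal{F}^S_P))$. *)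

theory Defs
  imports Main "HOL-Library.Sublist" "HOL-Library.Omega_Words_Fun"
begin

definition omega_words :: "'a set \<Rightarrow> 'a word set" where
  "omega_words A = {\<alpha>. range \<alpha> \<subseteq> A}"

definition fin_Pre :: "'a list set \<Rightarrow> 'a list set" where
  "fin_Pre L = (\<Union>w\<in>L. {u. Sublist.prefix u w})"

definition prefix_closed :: "'a list set \<Rightarrow> bool" where
  "prefix_closed L \<longleftrightarrow> L = fin_Pre L"

definition prefixes_of :: "'a word \<Rightarrow> 'a list set" where
  "prefixes_of \<alpha> = {\<alpha> [0 \<rightarrow> n] | n. True}"

definition inf_Pre :: "'a word set \<Rightarrow> 'a list set" where
  "inf_Pre L = (\<Union>\<alpha>\<in>L. prefixes_of \<alpha>)"

text \<open>If \<open>L \<subseteq> lists A\<close>, then \<open>Lim L \<subseteq> omega_words A\<close> holds automatically.\<close>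

definition Lim :: "'a list set \<Rightarrow> 'a word set" where
  "Lim L = {\<alpha>. infinite (prefixes_of \<alpha> \<inter> L)}"

definition control_patterns :: "'a set \<Rightarrow> 'a set \<Rightarrow> 'a set set" where
  "control_patterns \<Sigma> \<Sigma>uc = {\<gamma>. \<gamma> \<subseteq> \<Sigma> \<and> \<Sigma>uc \<subseteq> \<gamma>}"

definition string_supervisor :: "'a set \<Rightarrow> 'a set \<Rightarrow> ('a list \<Rightarrow> 'a set) \<Rightarrow> bool" where
  "string_supervisor \<Sigma> \<Sigma>uc f \<longleftrightarrow> (\<forall>s\<in>lists \<Sigma>. f s \<in> control_patterns \<Sigma> \<Sigma>uc)"

definition string_consistent :: "'a set \<Rightarrow> ('a list \<Rightarrow> 'a set) \<Rightarrow> 'a list \<Rightarrow> bool" where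
  "string_consistent \<Sigma> f s \<longleftrightarrow>
     (\<forall>t\<in>lists \<Sigma>. \<forall>\<sigma>\<in>\<Sigma>. Sublist.prefix (t @ [\<sigma>]) s \<longrightarrow> \<sigma> \<in> f t)"

definition sup_lang :: "'a set \<Rightarrow> ('a list \<Rightarrow> 'a set) \<Rightarrow> 'a list set" where
  "sup_lang \<Sigma> f = {s \<in> lists \<Sigma>. string_consistent \<Sigma> f s}"

definition sup_omega_lang :: "'a set \<Rightarrow> ('a list \<Rightarrow> 'a set) \<Rightarrow> 'a word set" where
  "sup_omega_lang \<Sigma> f = Lim (sup_lang \<Sigma> f)"

definition solves_string_synthesis ::
  "'a set \<Rightarrow> 'a list set \<Rightarrow> 'a word set \<Rightarrow> 'a word set \<Rightarrow> ('a list \<Rightarrow> 'a set) \<Rightarrow> bool" where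
  "solves_string_synthesis \<Sigma> LPfin LP LS f \<longleftrightarrow>
     {} \<subset> sup_omega_lang \<Sigma> f \<inter> LP \<and>
     sup_omega_lang \<Sigma> f \<inter> LP \<subseteq> LS \<and>
     sup_lang \<Sigma> f \<inter> LPfin \<subseteq> inf_Pre (sup_omega_lang \<Sigma> f \<inter> LP)"

record ('x, 'a) fsm =
  states :: "'x set"
  alphabet :: "'a set"
  delta :: "'x \<times> 'a \<rightharpoonup> 'x set"
  initial :: 'x

definition is_fsm :: "('x, 'a) fsm \<Rightarrow> bool" where
  "is_fsm M \<longleftrightarrow>
     finite (states M) \<and> finite (alphabet M) \<and> initial M \<in> states M \<and>
     dom (delta M) \<subseteq> states M \<times> alphabet M \<and> ran (delta M) \<subseteq> Pow (states M)"

definition deterministic :: "('x, 'a) fsm \<Rightarrow> bool" where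
  "deterministic M \<longleftrightarrow>
     (\<forall>x\<in>states M. \<forall>\<sigma>\<in>alphabet M. \<forall>Y. delta M (x, \<sigma>) = Some Y \<longrightarrow> (\<exists>y. Y = {y}))"

definition step :: "('x, 'a) fsm \<Rightarrow> 'x \<Rightarrow> 'a \<Rightarrow> 'x \<Rightarrow> bool" where
  "step M x \<sigma> x' \<longleftrightarrow> (\<exists>Y. delta M (x, \<sigma>) = Some Y \<and> x' \<in> Y)"

text \<open>Every path starts in the initial state; in particular, finite paths are nonempty.\<close>

definition fin_paths :: "('x, 'a) fsm \<Rightarrow> 'x list set" where
  "fin_paths M = {\<pi> \<in> lists (states M). \<pi> \<noteq> [] \<and> hd \<pi> = initial M \<and>
     (\<forall>k. Suc k < length \<pi> \<longrightarrow> (\<exists>\<sigma>\<in>alphabet M. step M (\<pi> ! k) \<sigma> (\<pi> ! Suc k)))}"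

definition inf_paths :: "('x, 'a) fsm \<Rightarrow> 'x word set" where
  "inf_paths M = {\<pi> \<in> omega_words (states M). \<pi> 0 = initial M \<and>
     (\<forall>k. \<exists>\<sigma>\<in>alphabet M. step M (\<pi> k) \<sigma> (\<pi> (Suc k)))}"

definition fin_paths_of :: "('x, 'a) fsm \<Rightarrow> 'a list \<Rightarrow> 'x list set" where
  "fin_paths_of M s = {\<pi> \<in> fin_paths M. length \<pi> = length s + 1 \<and>
     (\<forall>k < length s. step M (\<pi> ! k) (s ! k) (\<pi> ! Suc k))}"

definition inf_paths_of :: "('x, 'a) fsm \<Rightarrow> 'a word \<Rightarrow> 'x word set" where
  "inf_paths_of M \<alpha> = {\<pi> \<in> inf_paths M. \<forall>k. step M (\<pi> k) (\<alpha> k) (\<pi> (Suc k))}"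

definition fsm_lang :: "('x, 'a) fsm \<Rightarrow> 'a list set" where
  "fsm_lang M = {s \<in> lists (alphabet M). fin_paths_of M s \<noteq> {}}"

type_synonym 'x acc_pairs = "('x set \<times> 'x set) set"

definition rabin :: "'x acc_pairs \<Rightarrow> 'x word \<Rightarrow> bool" where
  "rabin F \<pi> \<longleftrightarrow> (\<exists>(G, R)\<in>F. limit \<pi> \<inter> G \<noteq> {} \<and> limit \<pi> \<inter> R = {})"

definition streett :: "'x acc_pairs \<Rightarrow> 'x word \<Rightarrow> bool" where
  "streett F \<pi> \<longleftrightarrow> (\<forall>(G, R)\<in>F. limit \<pi> \<inter> G = {} \<or> limit \<pi> \<inter> R \<noteq> {})"

definition acc_paths :: "('x, 'a) fsm \<Rightarrow> ('x word \<Rightarrow> bool) \<Rightarrow> 'x word set" where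
  "acc_paths M acc = {\<pi> \<in> inf_paths M. acc \<pi>}"

definition acc_lang :: "('x, 'a) fsm \<Rightarrow> ('x word \<Rightarrow> bool) \<Rightarrow> 'a word set" where
  "acc_lang M acc = {\<alpha> \<in> omega_words (alphabet M). \<exists>\<pi>\<in>inf_paths_of M \<alpha>. acc \<pi>}"

definition synthesis_automaton ::
  "('x, 'a) fsm \<Rightarrow> 'x acc_pairs \<Rightarrow> 'x acc_pairs \<Rightarrow>
   'a list set \<Rightarrow> 'a word set \<Rightarrow> 'a word set \<Rightarrow> bool" where
  "synthesis_automaton M FP FS LPfin LP LS \<longleftrightarrow>
     is_fsm M \<and>
     FP \<subseteq> Pow (states M) \<times> Pow (states M) \<and>
     FS \<subseteq> Pow (states M) \<times> Pow (states M) \<and>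
     LPfin = fsm_lang M \<and>
     LP = acc_lang M (streett FP) \<and>
     LS = acc_lang M (rabin FS) \<and>
     deterministic M \<and>
     (\<forall>x\<in>states M. \<forall>\<sigma>\<in>alphabet M. \<forall>\<sigma>'\<in>alphabet M.
        delta M (x, \<sigma>) \<noteq> None \<longrightarrow> delta M (x, \<sigma>') \<noteq> None \<longrightarrow>
        delta M (x, \<sigma>) = delta M (x, \<sigma>') \<longrightarrow> \<sigma> = \<sigma>')"

definition path_supervisor ::
  "('x, 'a) fsm \<Rightarrow> 'a set \<Rightarrow> ('x list \<Rightarrow> 'a set) \<Rightarrow> bool" where
  "path_supervisor M \<Sigma>uc g \<longleftrightarrow> (\<forall>\<pi>\<in>fin_paths M. g \<pi> \<in> control_patterns (alphabet M) \<Sigma>uc)"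

definition path_consistent :: "('x, 'a) fsm \<Rightarrow> ('x list \<Rightarrow> 'a set) \<Rightarrow> 'x list \<Rightarrow> bool" where
  "path_consistent M g \<pi> \<longleftrightarrow>
     (\<forall>x\<in>states M. \<forall>x'\<in>states M. \<forall>\<nu>\<in>lists (states M).
        Sublist.prefix (\<nu> @ [x, x']) \<pi> \<longrightarrow>
        (\<exists>\<sigma>\<in>g (\<nu> @ [x]). delta M (x, \<sigma>) = Some {x'}))"

definition sup_fin_paths :: "('x, 'a) fsm \<Rightarrow> ('x list \<Rightarrow> 'a set) \<Rightarrow> 'x list set" where
  "sup_fin_paths M g = {\<pi> \<in> fin_paths M. path_consistent M g \<pi>}"

definition sup_inf_paths :: "('x, 'a) fsm \<Rightarrow> ('x list \<Rightarrow> 'a set) \<Rightarrow> 'x word set" where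
  "sup_inf_paths M g = Lim (sup_fin_paths M g)"

definition solves_path_synthesis ::
  "('x, 'a) fsm \<Rightarrow> 'x acc_pairs \<Rightarrow> 'x acc_pairs \<Rightarrow> ('x list \<Rightarrow> 'a set) \<Rightarrow> bool" where
  "solves_path_synthesis M FP FS g \<longleftrightarrow>
     {} \<subset> sup_inf_paths M g \<inter> acc_paths M (streett FP) \<and>
     sup_inf_paths M g \<inter> acc_paths M (streett FP) \<subseteq> acc_paths M (rabin FS) \<and>
     sup_fin_paths M g \<subseteq> inf_Pre (sup_inf_paths M g \<inter> acc_paths M (streett FP))"

end

theory Submission
  imports Defs
begin

text \<open>
  In a deterministic machine whose transitions out of a state have pairwise distinct targets, the
  labels of a run determine its states and the states determine its labels, for finite and for
  infinite runs. Under this correspondence of words and paths, a word follows the string-based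
  supervisor if and only if its path follows the path-based one: both conditions compare the label
  of each transition with the same control pattern. Hence the two synthesis problems are translates
  of each other. The state sequence of a word of length \<open>n\<close> has length \<open>n + 1\<close>, so
  consistent paths are closed under nonempty prefixes only.
\<close>

section \<open>Limits and consistency expressed by positions\<close>

lemma take_prefix_word: "k \<le> n \<Longrightarrow> take k (\<alpha> [0 \<rightarrow> n]) = \<alpha> [0 \<rightarrow> k]"
  by (simp add: subsequence_def take_map)

text \<open>Prefixes of different lengths are different, so counting the prefixes in
  \<open>L\<close> amounts to counting their lengths.\<close>

lemma Lim_iff_infinite_lengths: "\<alpha> \<in> Lim L \<longleftrightarrow> infinite {n. \<alpha> [0 \<rightarrow> n] \<in> L}"
proof -
  have "inj_on (\<lambda>n. \<alpha> [0 \<rightarrow> n]) {n. \<alpha> [0 \<rightarrow> n] \<in> L}"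
    by (rule inj_onI) (metis diff_zero subsequence_length)
  moreover have "prefixes_of \<alpha> \<inter> L = (\<lambda>n. \<alpha> [0 \<rightarrow> n]) ` {n. \<alpha> [0 \<rightarrow> n] \<in> L}"
    by (auto simp: prefixes_of_def)
  ultimately show ?thesis
    by (simp add: Lim_def finite_image_iff)
qed

text \<open>An infinite set of lengths is unbounded, so every length from \<open>m\<close> on lies
  below one whose prefix is in \<open>L\<close>, and closure descends from there. The threshold
  \<open>m\<close> is 0 for words and 1 for state sequences, since the empty sequence is not a
  path.\<close>

lemma Lim_iff_all_prefixes:
  assumes "\<And>k n. m \<le> k \<Longrightarrow> k \<le> n \<Longrightarrow> \<alpha> [0 \<rightarrow> n] \<in> L \<Longrightarrow> \<alpha> [0 \<rightarrow> k] \<in> L"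
  shows "\<alpha> \<in> Lim L \<longleftrightarrow> (\<forall>n\<ge>m. \<alpha> [0 \<rightarrow> n] \<in> L)"
  unfolding Lim_iff_infinite_lengths infinite_nat_iff_unbounded_le
  by (metis assms mem_Collect_eq nat_le_linear)

text \<open>A factorization of a prefix as \<open>t @ [\<sigma>]\<close> is determined by the length
  of \<open>t\<close>, so the quantifiers over words and letters become one over positions.\<close>

lemma string_consistent_iff:
  assumes "s \<in> lists \<Sigma>"
  shows "string_consistent \<Sigma> f s \<longleftrightarrow> (\<forall>k<length s. s ! k \<in> f (take k s))"
proof
  assume c: "string_consistent \<Sigma> f s"
  show "\<forall>k<length s. s ! k \<in> f (take k s)"
  proof (intro allI impI)
    fix k assume k: "k < length s"
    then have "Sublist.prefix (take k s @ [s ! k]) s"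
      by (metis take_Suc_conv_app_nth take_is_prefix)
    moreover have "take k s \<in> lists \<Sigma>" "s ! k \<in> \<Sigma>"
      using assms k by (auto simp: in_lists_conv_set dest: in_set_takeD)
    ultimately show "s ! k \<in> f (take k s)"
      using c by (simp add: string_consistent_def)
  qed
next
  assume *: "\<forall>k<length s. s ! k \<in> f (take k s)"
  show "string_consistent \<Sigma> f s"
    unfolding string_consistent_def
  proof (intro ballI impI)
    fix t \<sigma> assume "Sublist.prefix (t @ [\<sigma>]) s"
    then obtain zs where "s = t @ \<sigma> # zs"
      by (auto simp: prefix_def)
    then show "\<sigma> \<in> f t"
      using *[rule_format, of "length t"] by simp
  qed
qed

text \<open>Here the factorization is determined by the length of \<open>\<nu>\<close>. The pattern
  for transition \<open>k\<close> is read after \<open>Suc k\<close> states, whereas for words it is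
  read after \<open>k\<close> letters.\<close>

lemma path_consistent_iff:
  assumes "\<pi> \<in> lists (states M)"
  shows "path_consistent M g \<pi> \<longleftrightarrow>
    (\<forall>k. Suc k < length \<pi> \<longrightarrow>
      (\<exists>\<sigma>\<in>g (take (Suc k) \<pi>). delta M (\<pi> ! k, \<sigma>) = Some {\<pi> ! Suc k}))"
    (is "_ \<longleftrightarrow> (\<forall>k. _ \<longrightarrow> ?ok k)")
proof
  assume c: "path_consistent M g \<pi>"
  show "\<forall>k. Suc k < length \<pi> \<longrightarrow> ?ok k"
  proof (intro allI impI)
    fix k assume k: "Suc k < length \<pi>"
    then have "take k \<pi> @ [\<pi> ! k, \<pi> ! Suc k] = take (Suc (Suc k)) \<pi>"
      by (simp add: take_Suc_conv_app_nth)
    then have "Sublist.prefix (take k \<pi> @ [\<pi> ! k, \<pi> ! Suc k]) \<pi>"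
      by (metis take_is_prefix)
    moreover have "take k \<pi> \<in> lists (states M)" "\<pi> ! k \<in> states M" "\<pi> ! Suc k \<in> states M"
      using assms k by (auto simp: in_lists_conv_set dest: in_set_takeD)
    ultimately have "\<exists>\<sigma>\<in>g (take k \<pi> @ [\<pi> ! k]). delta M (\<pi> ! k, \<sigma>) = Some {\<pi> ! Suc k}"
      using c by (simp add: path_consistent_def)
    then show "?ok k"
      using k by (simp add: take_Suc_conv_app_nth)
  qed
next
  assume *: "\<forall>k. Suc k < length \<pi> \<longrightarrow> ?ok k"
  show "path_consistent M g \<pi>"
    unfolding path_consistent_def
  proof (intro ballI impI)
    fix x x' \<nu> assume "Sublist.prefix (\<nu> @ [x, x']) \<pi>"
    then obtain zs where "\<pi> = \<nu> @ x # x' # zs"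
      by (auto simp: prefix_def)
    then show "\<exists>\<sigma>\<in>g (\<nu> @ [x]). delta M (x, \<sigma>) = Some {x'}"
      using *[rule_format, of "length \<nu>"] by (simp add: nth_append)
  qed
qed

section \<open>Prefix closure and initial segments of infinite runs\<close>

lemma take_sup_lang: "s \<in> sup_lang \<Sigma> f \<Longrightarrow> take n s \<in> sup_lang \<Sigma> f"
  unfolding sup_lang_def string_consistent_def in_lists_conv_set mem_Collect_eq
  by (meson in_set_takeD prefix_order.trans take_is_prefix)

lemma take_fin_paths: "\<pi> \<in> fin_paths M \<Longrightarrow> 0 < n \<Longrightarrow> take n \<pi> \<in> fin_paths M"
  by (auto simp: fin_paths_def in_lists_conv_set dest: in_set_takeD)

lemma take_sup_fin_paths: "\<pi> \<in> sup_fin_paths M g \<Longrightarrow> 0 < n \<Longrightarrow> take n \<pi> \<in> sup_fin_paths M g"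
  unfolding sup_fin_paths_def path_consistent_def mem_Collect_eq
  by (meson prefix_order.trans take_fin_paths take_is_prefix)

lemma take_fin_paths_of:
  assumes "\<pi> \<in> fin_paths_of M s" "k \<le> length s"
  shows "take (Suc k) \<pi> \<in> fin_paths_of M (take k s)"
  using assms by (auto simp: fin_paths_of_def intro: take_fin_paths)

lemma sup_omega_lang_iff: "\<alpha> \<in> sup_omega_lang \<Sigma> f \<longleftrightarrow> (\<forall>n. \<alpha> [0 \<rightarrow> n] \<in> sup_lang \<Sigma> f)"
proof -
  have "\<alpha> [0 \<rightarrow> k] \<in> sup_lang \<Sigma> f" if "k \<le> n" "\<alpha> [0 \<rightarrow> n] \<in> sup_lang \<Sigma> f" for k n
    using take_sup_lang[OF that(2), of k] that(1) by (simp add: take_prefix_word)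
  then show ?thesis
    unfolding sup_omega_lang_def by (subst Lim_iff_all_prefixes[where m = 0]) auto
qed

text \<open>The shift to \<open>Suc n\<close> absorbs the threshold 1 and aligns the
  \<open>n\<close>-th condition with that of \<open>sup_omega_lang_iff\<close>: \<open>n\<close>
  letters go with \<open>n + 1\<close> states.\<close>

lemma sup_inf_paths_iff: "\<pi> \<in> sup_inf_paths M g \<longleftrightarrow> (\<forall>n. \<pi> [0 \<rightarrow> Suc n] \<in> sup_fin_paths M g)"
proof -
  have "\<pi> [0 \<rightarrow> k] \<in> sup_fin_paths M g"
    if "1 \<le> k" "k \<le> n" "\<pi> [0 \<rightarrow> n] \<in> sup_fin_paths M g" for k n
    using take_sup_fin_paths[OF that(3), of k] that(1,2) by (simp add: take_prefix_word)
  then have "\<pi> \<in> sup_inf_paths M g \<longleftrightarrow> (\<forall>n\<ge>1. \<pi> [0 \<rightarrow> n] \<in> sup_fin_paths M g)"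
    unfolding sup_inf_paths_def by (rule Lim_iff_all_prefixes)
  then show ?thesis
    by (metis One_nat_def Suc_le_D Suc_le_mono zero_le)
qed

lemma inf_paths_of_prefix:
  assumes "\<pi> \<in> inf_paths_of M \<alpha>"
  shows "\<pi> [0 \<rightarrow> Suc n] \<in> fin_paths_of M (\<alpha> [0 \<rightarrow> n])"
proof -
  have nth: "\<pi> [0 \<rightarrow> Suc n] ! k = \<pi> k" if "k \<le> n" for k
    using that by (simp add: subsequence_def del: upt_Suc)
  have "hd (\<pi> [0 \<rightarrow> Suc n]) = \<pi> 0"
    by (simp add: subsequence_def hd_map del: upt_Suc)
  moreover have "\<pi> [0 \<rightarrow> Suc n] \<noteq> []"
    by (simp add: subsequence_def)
  moreover have "\<pi> [0 \<rightarrow> Suc n] \<in> lists (states M)"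
    using assms by (auto simp: inf_paths_of_def inf_paths_def omega_words_def subsequence_def range_subsetD)
  ultimately show ?thesis
    using assms by (auto simp: fin_paths_of_def fin_paths_def inf_paths_of_def inf_paths_def nth
        simp del: subseq_to_Suc)
qed

section \<open>Words and paths determine each other\<close>

locale synthesis_fsm =
  fixes M :: "('x, 'a) fsm"
  assumes fsm: "is_fsm M"
    and det: "deterministic M"
    and label_inj: "\<forall>x\<in>states M. \<forall>\<sigma>\<in>alphabet M. \<forall>\<sigma>'\<in>alphabet M.
      delta M (x, \<sigma>) \<noteq> None \<longrightarrow> delta M (x, \<sigma>') \<noteq> None \<longrightarrow>
      delta M (x, \<sigma>) = delta M (x, \<sigma>') \<longrightarrow> \<sigma> = \<sigma>'"
begin

lemma delta_dom: "delta M (x, \<sigma>) = Some Y \<Longrightarrow> x \<in> states M \<and> \<sigma> \<in> alphabet M"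
  using fsm unfolding is_fsm_def by blast

text \<open>Determinism makes the successor set a singleton, which is the form in which path
  consistency refers to transitions.\<close>

lemma step_iff: "step M x \<sigma> y \<longleftrightarrow> delta M (x, \<sigma>) = Some {y}"
  using det delta_dom unfolding step_def deterministic_def by blast

lemma step_target_unique: "step M x \<sigma> y \<Longrightarrow> step M x \<sigma> z \<Longrightarrow> y = z"
  by (simp add: step_iff)

text \<open>Both labels have the same successor set \<open>{y}\<close>, so \<open>label_inj\<close>
  identifies them.\<close>

lemma step_label_unique: "step M x \<sigma> y \<Longrightarrow> step M x \<sigma>' y \<Longrightarrow> \<sigma> = \<sigma>'"
  using label_inj delta_dom unfolding step_iff by (metis option.distinct(1))

lemma step_alphabet: "step M x \<sigma> y \<Longrightarrow> \<sigma> \<in> alphabet M"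
  using delta_dom unfolding step_iff by blast

lemma fin_paths_of_unique:
  assumes "\<pi> \<in> fin_paths_of M s" "\<rho> \<in> fin_paths_of M s"
  shows "\<pi> = \<rho>"
proof (rule nth_equalityI)
  show "length \<pi> = length \<rho>"
    using assms by (simp add: fin_paths_of_def)
  fix k assume "k < length \<pi>"
  then show "\<pi> ! k = \<rho> ! k"
  proof (induction k)
    case 0
    then show ?case
      using assms by (simp add: fin_paths_of_def fin_paths_def flip: hd_conv_nth)
  next
    case (Suc k)
    then have "\<pi> ! k = \<rho> ! k" "k < length s"
      using assms by (auto simp: fin_paths_of_def)
    then show ?case
      using assms by (auto simp: fin_paths_of_def intro: step_target_unique)
  qed
qed

lemma fin_paths_of_word_unique:
  assumes "\<pi> \<in> fin_paths_of M s" "\<pi> \<in> fin_paths_of M t"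
  shows "s = t"
proof (rule nth_equalityI)
  show len: "length s = length t"
    using assms by (simp add: fin_paths_of_def)
  fix k assume "k < length s"
  then have "step M (\<pi> ! k) (s ! k) (\<pi> ! Suc k)" "step M (\<pi> ! k) (t ! k) (\<pi> ! Suc k)"
    using assms len by (simp_all add: fin_paths_of_def)
  then show "s ! k = t ! k"
    by (rule step_label_unique)
qed

lemma fin_paths_of_alphabet: "\<pi> \<in> fin_paths_of M s \<Longrightarrow> s \<in> lists (alphabet M)"
  by (auto simp: fin_paths_of_def in_set_conv_nth) (metis step_alphabet)

lemma fin_paths_of_fsm_lang: "\<pi> \<in> fin_paths_of M s \<Longrightarrow> s \<in> fsm_lang M"
  using fin_paths_of_alphabet by (auto simp: fsm_lang_def)

lemma fin_path_has_word:
  assumes "\<pi> \<in> fin_paths M"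
  obtains s where "\<pi> \<in> fin_paths_of M s"
proof -
  have "\<forall>k. \<exists>\<sigma>. Suc k < length \<pi> \<longrightarrow> step M (\<pi> ! k) \<sigma> (\<pi> ! Suc k)"
    using assms by (auto simp: fin_paths_def)
  then obtain l where "\<And>k. Suc k < length \<pi> \<Longrightarrow> step M (\<pi> ! k) (l k) (\<pi> ! Suc k)"
    by metis
  \<comment> \<open>A path is nonempty and has one transition fewer than states, so the chosen
    labels form a word of length \<open>length \<pi> - 1\<close>.\<close>
  then have "\<pi> \<in> fin_paths_of M (map l [0..<length \<pi> - 1])"
    using assms by (auto simp: fin_paths_of_def fin_paths_def)
  then show ?thesis
    by (rule that)
qed

lemma inf_path_has_word:
  assumes "\<pi> \<in> inf_paths M"
  obtains \<alpha> where "\<pi> \<in> inf_paths_of M \<alpha>"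
proof -
  have "\<forall>k. \<exists>\<sigma>. step M (\<pi> k) \<sigma> (\<pi> (Suc k))"
    using assms by (auto simp: inf_paths_def)
  then obtain \<alpha> where "\<And>k. step M (\<pi> k) (\<alpha> k) (\<pi> (Suc k))"
    by metis
  then have "\<pi> \<in> inf_paths_of M \<alpha>"
    using assms by (simp add: inf_paths_of_def)
  then show ?thesis
    by (rule that)
qed

lemma inf_paths_of_unique:
  assumes "\<pi> \<in> inf_paths_of M \<alpha>" "\<rho> \<in> inf_paths_of M \<alpha>"
  shows "\<pi> = \<rho>"
proof
  fix k show "\<pi> k = \<rho> k"
  proof (induction k)
    case 0
    then show ?case
      using assms by (simp add: inf_paths_of_def inf_paths_def)
  next
    case (Suc k)
    have "step M (\<pi> k) (\<alpha> k) (\<pi> (Suc k))" "step M (\<rho> k) (\<alpha> k) (\<rho> (Suc k))"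
      using assms by (auto simp: inf_paths_of_def)
    with Suc show ?case
      by (auto intro: step_target_unique)
  qed
qed

text \<open>Acceptance asks for some accepting run, and \<open>\<pi>\<close> is the only run on
  \<open>\<alpha>\<close>. Keeping \<open>acc\<close> arbitrary serves the Streett and the Rabin
  condition alike.\<close>

lemma acc_lang_iff:
  assumes "\<pi> \<in> inf_paths_of M \<alpha>"
  shows "\<alpha> \<in> acc_lang M acc \<longleftrightarrow> \<pi> \<in> acc_paths M acc"
proof -
  have "\<alpha> \<in> omega_words (alphabet M)"
    using assms by (auto simp: inf_paths_of_def omega_words_def intro: step_alphabet)
  moreover have "\<pi> \<in> inf_paths M"
    using assms by (simp add: inf_paths_of_def)
  ultimately show ?thesis
    using assms inf_paths_of_unique unfolding acc_lang_def acc_paths_def by blast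
qed

section \<open>Transfer of consistency and prefixes along runs\<close>

lemma sup_lang_iff_sup_fin_paths:
  assumes fg: "\<forall>s\<in>fsm_lang M. f s = g (THE \<pi>. \<pi> \<in> fin_paths_of M s)"
    and run: "\<pi> \<in> fin_paths_of M s"
  shows "s \<in> sup_lang (alphabet M) f \<longleftrightarrow> \<pi> \<in> sup_fin_paths M g"
proof -
  have f_eq: "f (take k s) = g (take (Suc k) \<pi>)" if "k < length s" for k
  proof -
    have r: "take (Suc k) \<pi> \<in> fin_paths_of M (take k s)"
      using take_fin_paths_of[OF run] that by simp
    \<comment> \<open>Uniqueness of the run on \<open>take k s\<close> makes the description denote
      the initial segment of \<open>\<pi>\<close>.\<close>
    then have "(THE \<rho>. \<rho> \<in> fin_paths_of M (take k s)) = take (Suc k) \<pi>"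
      using fin_paths_of_unique by blast
    then show ?thesis
      using fg fin_paths_of_fsm_lang[OF r] by simp
  qed
  have path: "\<pi> \<in> fin_paths M" "\<pi> \<in> lists (states M)" and len: "length \<pi> = Suc (length s)"
    and steps: "\<And>k. k < length s \<Longrightarrow> step M (\<pi> ! k) (s ! k) (\<pi> ! Suc k)"
    using run by (auto simp: fin_paths_of_def fin_paths_def)
  \<comment> \<open>The only label leading from \<open>\<pi> ! k\<close> to
    \<open>\<pi> ! Suc k\<close> is \<open>s ! k\<close>, so the existential reduces to testing this
    one label.\<close>
  have "(\<exists>\<sigma>\<in>g (take (Suc k) \<pi>). delta M (\<pi> ! k, \<sigma>) = Some {\<pi> ! Suc k}) \<longleftrightarrow>
      s ! k \<in> f (take k s)" if "k < length s" for k
    using steps[OF that] f_eq[OF that] step_label_unique by (metis step_iff)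
  then show ?thesis
    using fin_paths_of_alphabet[OF run] path
    by (auto simp: sup_lang_def sup_fin_paths_def string_consistent_iff path_consistent_iff len)
qed

lemma sup_omega_lang_iff_sup_inf_paths:
  assumes fg: "\<forall>s\<in>fsm_lang M. f s = g (THE \<pi>. \<pi> \<in> fin_paths_of M s)"
    and run: "\<pi> \<in> inf_paths_of M \<alpha>"
  shows "\<alpha> \<in> sup_omega_lang (alphabet M) f \<longleftrightarrow> \<pi> \<in> sup_inf_paths M g"
  unfolding sup_omega_lang_iff sup_inf_paths_iff
  using sup_lang_iff_sup_fin_paths[OF fg inf_paths_of_prefix[OF run]] by simp

lemma prefixes_of_iff:
  assumes "\<pi> \<in> inf_paths_of M \<alpha>" "\<rho> \<in> fin_paths_of M s"
  shows "s \<in> prefixes_of \<alpha> \<longleftrightarrow> \<rho> \<in> prefixes_of \<pi>"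
proof
  assume "s \<in> prefixes_of \<alpha>"
  then obtain n where "s = \<alpha> [0 \<rightarrow> n]"
    by (auto simp: prefixes_of_def)
  then have "\<rho> = \<pi> [0 \<rightarrow> Suc n]"
    using fin_paths_of_unique[OF assms(2)] inf_paths_of_prefix[OF assms(1)] by blast
  then show "\<rho> \<in> prefixes_of \<pi>"
    unfolding prefixes_of_def by blast
next
  assume "\<rho> \<in> prefixes_of \<pi>"
  then obtain m where m: "\<rho> = \<pi> [0 \<rightarrow> m]"
    by (auto simp: prefixes_of_def)
  moreover have "length \<rho> = Suc (length s)"
    using assms(2) by (simp add: fin_paths_of_def)
  \<comment> \<open>Comparing lengths fixes \<open>m\<close>; in particular the empty prefix of
    \<open>\<pi>\<close>, which corresponds to no word, is excluded.\<close>
  ultimately have "\<rho> = \<pi> [0 \<rightarrow> Suc (length s)]"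
    by simp
  then have "s = \<alpha> [0 \<rightarrow> length s]"
    using fin_paths_of_word_unique[OF assms(2)] inf_paths_of_prefix[OF assms(1)] by blast
  then show "s \<in> prefixes_of \<alpha>"
    unfolding prefixes_of_def by blast
qed

section \<open>Equivalence of the two synthesis problems\<close>

theorem solves_synthesis_iff:
  assumes fg: "\<forall>s\<in>fsm_lang M. f s = g (THE \<pi>. \<pi> \<in> fin_paths_of M s)"
  shows "solves_string_synthesis (alphabet M) (fsm_lang M)
      (acc_lang M (streett FP)) (acc_lang M (rabin FS)) f \<longleftrightarrow>
    solves_path_synthesis M FP FS g"
proof -
  define W where "W = sup_omega_lang (alphabet M) f \<inter> acc_lang M (streett FP)"
  define P where "P = sup_inf_paths M g \<inter> acc_paths M (streett FP)"
  have WP: "\<alpha> \<in> W \<longleftrightarrow> \<pi> \<in> P" if "\<pi> \<in> inf_paths_of M \<alpha>" for \<alpha> \<pi>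
    using sup_omega_lang_iff_sup_inf_paths[OF fg that] acc_lang_iff[OF that]
    by (simp add: W_def P_def)
  have W_run: "\<exists>\<pi>. \<pi> \<in> inf_paths_of M \<alpha>" if "\<alpha> \<in> W" for \<alpha>
    using that by (auto simp: W_def acc_lang_def)
  \<comment> \<open>Together with \<open>W_run\<close> this makes the correspondence total on both
    sides, so statements quantified over \<open>W\<close> and over \<open>P\<close> translate into
    each other.\<close>
  have P_run: "\<exists>\<alpha>. \<pi> \<in> inf_paths_of M \<alpha>" if "\<pi> \<in> P" for \<pi>
    using that inf_path_has_word[of \<pi>] by (auto simp: P_def acc_paths_def)
  have nonempty: "{} \<subset> W \<longleftrightarrow> {} \<subset> P"
    using WP W_run P_run by (metis bot.not_eq_extremum ex_in_conv)
  have incl: "W \<subseteq> acc_lang M (rabin FS) \<longleftrightarrow> P \<subseteq> acc_paths M (rabin FS)"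
    using WP W_run P_run acc_lang_iff by (meson subset_iff)
  have pre: "s \<in> inf_Pre W \<longleftrightarrow> \<rho> \<in> inf_Pre P" if "\<rho> \<in> fin_paths_of M s" for s \<rho>
    using WP W_run P_run prefixes_of_iff[OF _ that] unfolding inf_Pre_def by (metis UN_iff)
  \<comment> \<open>A word in \<open>sup_lang\<close> may have no run in \<open>M\<close>;
    intersecting with \<open>fsm_lang M\<close> keeps exactly the words that have a finite path as
    partner.\<close>
  have "sup_lang (alphabet M) f \<inter> fsm_lang M \<subseteq> inf_Pre W \<longleftrightarrow> sup_fin_paths M g \<subseteq> inf_Pre P"
  proof
    assume *: "sup_lang (alphabet M) f \<inter> fsm_lang M \<subseteq> inf_Pre W"
    show "sup_fin_paths M g \<subseteq> inf_Pre P"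
    proof
      fix \<rho> assume \<rho>: "\<rho> \<in> sup_fin_paths M g"
      then obtain s where s: "\<rho> \<in> fin_paths_of M s"
        using fin_path_has_word by (auto simp: sup_fin_paths_def)
      then have "s \<in> sup_lang (alphabet M) f \<inter> fsm_lang M"
        using \<rho> sup_lang_iff_sup_fin_paths[OF fg s] fin_paths_of_fsm_lang by blast
      with * show "\<rho> \<in> inf_Pre P"
        using pre[OF s] by blast
    qed
  next
    assume *: "sup_fin_paths M g \<subseteq> inf_Pre P"
    show "sup_lang (alphabet M) f \<inter> fsm_lang M \<subseteq> inf_Pre W"
    proof
      fix s assume s: "s \<in> sup_lang (alphabet M) f \<inter> fsm_lang M"
      then obtain \<rho> where \<rho>: "\<rho> \<in> fin_paths_of M s"
        by (auto simp: fsm_lang_def)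
      then show "s \<in> inf_Pre W"
        using s * pre[OF \<rho>] sup_lang_iff_sup_fin_paths[OF fg \<rho>] by blast
    qed
  qed
  with nonempty incl show ?thesis
    unfolding solves_string_synthesis_def solves_path_synthesis_def W_def P_def by blast
qed

end

theorem theorem1:
  fixes \<Sigma> \<Sigma>c \<Sigma>uc :: "'a set"
    and LPfin :: "'a list set"
    and LP LS :: "'a word set"
    and M :: "('x, 'a) fsm"
    and FP FS :: "'x acc_pairs"
    and f :: "'a list \<Rightarrow> 'a set"
    and g :: "'x list \<Rightarrow> 'a set"
  assumes "finite \<Sigma>" and "\<Sigma> = \<Sigma>c \<union> \<Sigma>uc" and "\<Sigma>c \<inter> \<Sigma>uc = {}"
    and "LPfin \<subseteq> lists \<Sigma>" and "prefix_closed LPfin"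
    and "LP \<subseteq> omega_words \<Sigma>" and "inf_Pre LP \<subseteq> LPfin"
    and "LS \<subseteq> omega_words \<Sigma>"
    and "alphabet M = \<Sigma>"
    and "synthesis_automaton M FP FS LPfin LP LS"
    and "string_supervisor \<Sigma> \<Sigma>uc f"
    and "path_supervisor M \<Sigma>uc g"
    and "\<And>s. s \<in> fsm_lang M \<Longrightarrow> f s = g (THE \<pi>. \<pi> \<in> fin_paths_of M s)"
  shows "solves_string_synthesis \<Sigma> LPfin LP LS f \<longleftrightarrow> solves_path_synthesis M FP FS g"
proof -
  \<comment> \<open>The realization hypothesis supplies the structural assumptions here, and below
    its equations replace \<open>LPfin\<close>, \<open>LP\<close> and \<open>LS\<close> by the
    languages of \<open>M\<close>.\<close>
  interpret synthesis_fsm M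
    using assms(10) by unfold_locales (simp_all add: synthesis_automaton_def)
  show ?thesis
    using solves_synthesis_iff[of f g FP FS] assms(9,10,13)
    by (simp add: synthesis_automaton_def)
qed

end
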